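(* Let $k\ge1$, let $\beta_1,\ldots,\beta_k$ be negative real numbers, let $(\alpha_n)$ be a sequence of real numbers with $\alpha_n\to\infty$, and let $\mathbb{P}^{(n)}$ be the directed exponential random graph measure with outward-star parameters $\beta_p^{(n)}=\beta_p\alpha_n$, $p=1,\ldots,k$ (defined in the context). Assume that $\lim_{n\to\infty}ne^{\alpha_n\beta_1}=0$ and $\lim_{n\to\infty}\frac{\alpha_n}{n}=0$. Then for all fixed vertices $i\ne j$, $$\lim_{n\to\infty}\frac{\mathbb{P}^{(n)}(X_{1i}=1,\,X_{1j}=1)}{e^{2\alpha_n\beta_1}}=1.$$
   Context: Directed graphs $G_n$ on the vertex set $\{1,\ldots,n\}$, with loops allowed, are represented by matrices $X_n=(X_{ij})_{1\le i,j\le n}$ with $X_{ij}\in\{0,1\}$, where $X_{ij}=1$ if and only if there is a directed edge from $i$ to $j$. For $p\ge1$ the directed $p$-star homomorphism density is $$s_p(X_n)=n^{-p-1}\sum_{1\le i,j_1,\ldots,j_p\le n}X_{ij_1}X_{ij_2}\cdots X_{ij_p}=n^{-p-1}\sum_{i=1}^n\left(\sum_{j=1}^nX_{ij}\right)^p.$$ The measure $\mathbb{P}^{(n)}$ on $\{0,1\}^{n\times n}$ is $$\mathbb{P}^{(n)}(G_n)=Z_n^{-1}\exp\left[n^2\sum_{p=1}^k\beta_p^{(n)}s_p(X_n)\right],\qquad \beta_p^{(n)}=\beta_p\alpha_n,$$ where $Z_n=\sum_{X_n\in\{0,1\}^{n\times n}}\exp\left[n^2\sum_{p=1}^k\beta_p^{(n)}s_p(X_n)\right]$.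 *)

theory Defs
  imports "HOL-Probability.Probability"
begin

text \<open>
  A directed graph on the vertex set \<open>{1..n}\<close> (loops allowed) is its 0/1 adjacency matrix,
  written as a curried function \<open>X i j\<close> that is extensional in both arguments, so that
  each graph is represented exactly once.
\<close>
definition digraphs :: "nat \<Rightarrow> (nat \<Rightarrow> nat \<Rightarrow> real) set" where
  "digraphs n = {1..n} \<rightarrow>\<^sub>E ({1..n} \<rightarrow>\<^sub>E {0, 1})"

text \<open>
  The directed star homomorphism density; the tuple \<open>j\<^sub>1, \<dots>, j\<^sub>p\<close>
  is the function \<open>j\<close>.
\<close>
definition star_density :: "nat \<Rightarrow> nat \<Rightarrow> (nat \<Rightarrow> nat \<Rightarrow> real) \<Rightarrow> real" where
  "star_density n p X =
     (\<Sum>i\<in>{1..n}. \<Sum>j\<in>{1..p} \<rightarrow>\<^sub>E {1..n}. \<Prod>l\<in>{1..p}. X i (j l)) / real n ^ (p + 1)"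

lemma star_density_altdef:
  "star_density n p X = (\<Sum>i=1..n. (\<Sum>j=1..n. X i j) ^ p) / real n ^ (p + 1)"
proof -
  have "(\<Sum>j\<in>{1..p} \<rightarrow>\<^sub>E {1..n}. \<Prod>l\<in>{1..p}. X i (j l)) = (\<Sum>j=1..n. X i j) ^ p" for i
    using prod_sum_PiE[of "{1..p}" "\<lambda>_. {1..n}" "\<lambda>_ j. X i j"] by simp
  then show ?thesis
    by (simp add: star_density_def)
qed

definition ergm_weight :: "nat \<Rightarrow> nat \<Rightarrow> (nat \<Rightarrow> real) \<Rightarrow> (nat \<Rightarrow> nat \<Rightarrow> real) \<Rightarrow> real" where
  "ergm_weight n k b X = exp (real n ^ 2 * (\<Sum>p=1..k. b p * star_density n p X))"

definition ergm_Z :: "nat \<Rightarrow> nat \<Rightarrow> (nat \<Rightarrow> real) \<Rightarrow> real" where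
  "ergm_Z n k b = (\<Sum>X\<in>digraphs n. ergm_weight n k b X)"

definition ergm :: "nat \<Rightarrow> nat \<Rightarrow> (nat \<Rightarrow> real) \<Rightarrow> (nat \<Rightarrow> nat \<Rightarrow> real) measure" where
  "ergm n k b = point_measure (digraphs n) (\<lambda>X. ennreal (ergm_weight n k b X / ergm_Z n k b))"

lemma finite_digraphs: "finite (digraphs n)"
  by (auto simp: digraphs_def intro!: finite_PiE)

lemma digraphs_nonempty: "digraphs n \<noteq> {}"
  by (auto simp: digraphs_def PiE_eq_empty_iff)

lemma ergm_Z_pos: "ergm_Z n k b > 0"
  unfolding ergm_Z_def ergm_weight_def
  by (intro sum_pos finite_digraphs digraphs_nonempty) auto

lemma prob_space_ergm: "prob_space (ergm n k b)"
proof (rule prob_spaceI)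
  have "emeasure (ergm n k b) (space (ergm n k b))
      = (\<Sum>X\<in>digraphs n. ennreal (ergm_weight n k b X / ergm_Z n k b))"
    by (simp add: ergm_def space_point_measure emeasure_point_measure_finite finite_digraphs)
  also have "\<dots> = ennreal (\<Sum>X\<in>digraphs n. ergm_weight n k b X / ergm_Z n k b)"
    using ergm_Z_pos[of n k b] by (intro sum_ennreal) (simp add: ergm_weight_def)
  also have "(\<Sum>X\<in>digraphs n. ergm_weight n k b X / ergm_Z n k b) = 1"
    using ergm_Z_pos[of n k b] by (simp flip: sum_divide_distrib ergm_Z_def)
  finally show "emeasure (ergm n k b) (space (ergm n k b)) = 1" by simp
qed

end

theory Submission imports Defs begin

text \<open>
  The weight of a digraph is a product over the rows of its adjacency matrix, so the rows are
  independent, and a row with \<open>r\<close> ones has weight \<open>exp (row_energy n k b r)\<close>. The probability that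
  row \<open>1\<close> has ones on \<open>J = {i, j}\<close> is therefore \<open>R J / R {}\<close>, where \<open>R J\<close> is the total weight of the
  rows with ones on \<open>J\<close>. Put \<open>q = exp (b 1)\<close>. Dropping all rows but the indicator of \<open>J\<close> bounds
  \<open>R J\<close> from below. Since all parameters are negative, dropping the stars with \<open>p \<ge> 2\<close> bounds it from
  above by \<open>q ^ card J * (1 + q) ^ n\<close>, where \<open>(1 + q) ^ n \<le> exp (n * q)\<close> tends to \<open>1\<close>. Both bounds
  are asymptotic to \<open>q ^ card J\<close>, because the stars with \<open>p \<ge> 2\<close> contribute to a row with boundedly
  many ones only \<open>O(\<alpha> / n)\<close>.
\<close>

text \<open>The exponent \<open>p - 1\<close> is what remains of \<open>n ^ (p + 1)\<close> in the
  star density after multiplication by \<open>n ^ 2\<close>; \<open>r\<close> stands for the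
  outdegree of a vertex.\<close>

definition row_energy :: "nat \<Rightarrow> nat \<Rightarrow> (nat \<Rightarrow> real) \<Rightarrow> real \<Rightarrow> real" where
  "row_energy n k b r = (\<Sum>p=1..k. b p * r ^ p / real n ^ (p - 1))"

text \<open>Forcing entries by choosing the factors of an extensional product, rather than by
  filtering, lets \<open>prod_sum_PiE\<close> factor sums over rows.\<close>

definition rows_with :: "nat \<Rightarrow> nat set \<Rightarrow> (nat \<Rightarrow> real) set" where
  "rows_with n J = (\<Pi>\<^sub>E m\<in>{1..n}. if m \<in> J then {1} else {0, 1})"

definition row_partition :: "nat \<Rightarrow> nat \<Rightarrow> (nat \<Rightarrow> real) \<Rightarrow> nat set \<Rightarrow> real" where
  "row_partition n k b J = (\<Sum>x\<in>rows_with n J. exp (row_energy n k b (\<Sum>m=1..n. x m)))"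

lemma finite_rows_with [simp]: "finite (rows_with n J)"
  by (auto simp: rows_with_def intro!: finite_PiE)

lemma rows_with_subset: "rows_with n J \<subseteq> {1..n} \<rightarrow>\<^sub>E {0, 1}"
  unfolding rows_with_def by (rule PiE_mono) auto

lemma ergm_weight_eq_prod:
  assumes "n \<ge> 1"
  shows "ergm_weight n k b X = (\<Prod>v=1..n. exp (row_energy n k b (\<Sum>m=1..n. X v m)))"
proof -
  have "real n ^ 2 * (b p * (s / real n ^ (p + 1))) = b p * s / real n ^ (p - 1)"
    if "p \<in> {1..k}" for p s
    using that assms by (cases p) (auto simp: field_simps power2_eq_square)
  then have "real n ^ 2 * (\<Sum>p=1..k. b p * star_density n p X)
      = (\<Sum>p=1..k. b p * (\<Sum>v=1..n. (\<Sum>m=1..n. X v m) ^ p) / real n ^ (p - 1))"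
    unfolding star_density_altdef sum_distrib_left[of "real n ^ 2"] by (intro sum.cong refl)
  also have "\<dots> = (\<Sum>v=1..n. row_energy n k b (\<Sum>m=1..n. X v m))"
    unfolding row_energy_def sum_distrib_left sum_divide_distrib by (rule sum.swap)
  finally show ?thesis
    by (simp add: ergm_weight_def exp_sum)
qed

text \<open>The event constrains row \<open>v\<close> alone, so it is itself a product over rows;
  this is what makes its total weight factor.\<close>

lemma digraphs_row_eq_PiE:
  assumes "v \<in> {1..n}" "J \<subseteq> {1..n}"
  shows "{X \<in> digraphs n. \<forall>m\<in>J. X v m = 1}
    = (\<Pi>\<^sub>E w\<in>{1..n}. rows_with n (if w = v then J else {}))" (is "?L = ?R")
proof (intro set_eqI iffI)
  fix X assume "X \<in> ?L"
  then have X: "X \<in> {1..n} \<rightarrow>\<^sub>E ({1..n} \<rightarrow>\<^sub>E {0, 1})" and J: "\<forall>m\<in>J. X v m = 1"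
    by (auto simp: digraphs_def)
  show "X \<in> ?R"
  proof (rule PiE_I)
    fix w assume "w \<in> {1..n}"
    with X have "X w \<in> {1..n} \<rightarrow>\<^sub>E {0, 1}" by (rule PiE_mem)
    with J show "X w \<in> rows_with n (if w = v then J else {})"
      by (auto simp: rows_with_def PiE_iff)
  qed (use X in \<open>auto simp: PiE_iff extensional_def\<close>)
next
  fix X assume X: "X \<in> ?R"
  have row: "X w \<in> rows_with n (if w = v then J else {})" if "w \<in> {1..n}" for w
    using X that by (rule PiE_mem)
  have "X \<in> digraphs n"
    unfolding digraphs_def
  proof (rule PiE_I)
    fix w assume "w \<in> {1..n}"
    from row[OF this] show "X w \<in> {1..n} \<rightarrow>\<^sub>E {0, 1}"
      by (rule rows_with_subset[THEN subsetD])
  qed (use X in \<open>auto simp: PiE_iff extensional_def\<close>)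
  moreover have "X v m = 1" if "m \<in> J" for m
    using row[OF assms(1)] that assms(2) by (force simp: rows_with_def PiE_iff)
  ultimately show "X \<in> ?L" by blast
qed

text \<open>A sum of products over a product set is a product of row sums, and only row
  \<open>v\<close> feels \<open>J\<close>. The case \<open>J = {}\<close> computes
  \<open>ergm_Z\<close>.\<close>

lemma sum_ergm_weight_row:
  assumes "v \<in> {1..n}" "J \<subseteq> {1..n}"
  shows "(\<Sum>X | X \<in> digraphs n \<and> (\<forall>m\<in>J. X v m = 1). ergm_weight n k b X)
    = row_partition n k b J * row_partition n k b {} ^ (n - 1)"
proof -
  have "n \<ge> 1" using assms by simp
  have "(\<Sum>X | X \<in> digraphs n \<and> (\<forall>m\<in>J. X v m = 1). ergm_weight n k b X)
     = (\<Sum>X\<in>(\<Pi>\<^sub>E w\<in>{1..n}. rows_with n (if w = v then J else {})).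
         \<Prod>w=1..n. exp (row_energy n k b (\<Sum>m=1..n. X w m)))"
    unfolding digraphs_row_eq_PiE[OF assms] ergm_weight_eq_prod[OF \<open>n \<ge> 1\<close>] ..
  also have "\<dots> = (\<Prod>w=1..n. row_partition n k b (if w = v then J else {}))"
    unfolding row_partition_def by (subst prod_sum_PiE) auto
  also have "\<dots> = row_partition n k b J * (\<Prod>w\<in>{1..n} - {v}. row_partition n k b {})"
    using assms by (subst prod.remove[of _ v]) (auto intro!: arg_cong2[of _ _ _ _ "(*)"] prod.cong)
  also have "\<dots> = row_partition n k b J * row_partition n k b {} ^ (n - 1)"
    using assms by simp
  finally show ?thesis .
qed

lemma measure_ergm:
  assumes "S \<subseteq> digraphs n"
  shows "measure (ergm n k b) S = (\<Sum>X\<in>S. ergm_weight n k b X) / ergm_Z n k b"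
proof -
  have nonneg: "ergm_weight n k b X / ergm_Z n k b \<ge> 0" for X
    using ergm_Z_pos[of n k b] by (simp add: ergm_weight_def)
  have "emeasure (ergm n k b) S = (\<Sum>X\<in>S. ennreal (ergm_weight n k b X / ergm_Z n k b))"
    unfolding ergm_def by (rule emeasure_point_measure_finite[OF finite_digraphs assms])
  also have "\<dots> = ennreal (\<Sum>X\<in>S. ergm_weight n k b X / ergm_Z n k b)"
    using nonneg by (rule sum_ennreal)
  finally show ?thesis
    using nonneg by (simp add: measure_def sum_nonneg sum_divide_distrib)
qed

lemma exp_row_energy_le_row_partition:
  assumes "J \<subseteq> {1..n}"
  shows "exp (row_energy n k b (card J)) \<le> row_partition n k b J"
proof -
  \<comment> \<open>The indicator of \<open>J\<close>, left \<open>undefined\<close> outside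
    \<open>{1..n}\<close> so that it lies in the extensional product.\<close>
  define x where "x = (\<lambda>m\<in>{1..n}. if m \<in> J then 1 else 0 :: real)"
  have "(\<Sum>m=1..n. x m) = (\<Sum>m=1..n. if m \<in> J then 1 else 0)"
    unfolding x_def by (intro sum.cong) auto
  also have "\<dots> = card J"
    using assms by (simp add: sum.If_cases Int_absorb1)
  finally have sum: "(\<Sum>m=1..n. x m) = card J" .
  have "x \<in> rows_with n J"
    by (auto simp: x_def rows_with_def)
  then have "exp (row_energy n k b (\<Sum>m=1..n. x m)) \<le> row_partition n k b J"
    unfolding row_partition_def by (intro member_le_sum) auto
  then show ?thesis by (simp only: sum)
qed

lemma row_partition_pos: "J \<subseteq> {1..n} \<Longrightarrow> row_partition n k b J > 0"
  by (rule less_le_trans[OF exp_gt_zero exp_row_energy_le_row_partition])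

text \<open>The zero row alone contributes 1, since every \<open>p\<close> in the energy is at least
  1 and so \<open>0 ^ p = 0\<close>. This bounds the denominator of the row probability.\<close>

lemma row_partition_empty_ge_1: "row_partition n k b {} \<ge> 1"
proof -
  have "row_energy n k b 0 = 0"
    by (auto simp: row_energy_def intro!: sum.neutral)
  then show ?thesis
    using exp_row_energy_le_row_partition[of "{}" n k b] by simp
qed

text \<open>The other \<open>n - 1\<close> rows contribute the same factor to the event and to
  \<open>ergm_Z\<close>, and it cancels.\<close>

lemma prob_row_eq:
  assumes "v \<in> {1..n}" "J \<subseteq> {1..n}"
  shows "measure (ergm n k b) {X \<in> digraphs n. \<forall>m\<in>J. X v m = 1}
    = row_partition n k b J / row_partition n k b {}"
proof -
  have "ergm_Z n k b = row_partition n k b {} * row_partition n k b {} ^ (n - 1)"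
    using sum_ergm_weight_row[OF assms(1), of "{}" k b] by (simp add: ergm_Z_def)
  then have "measure (ergm n k b) {X \<in> digraphs n. \<forall>m\<in>J. X v m = 1}
     = (row_partition n k b J * row_partition n k b {} ^ (n - 1))
       / (row_partition n k b {} * row_partition n k b {} ^ (n - 1))"
    by (simp add: measure_ergm sum_ergm_weight_row[OF assms])
  then show ?thesis
    using row_partition_pos[of "{}" n k b] by simp
qed

lemma row_energy_le_linear:
  assumes "k \<ge> 1" "\<And>p. p \<in> {1..k} \<Longrightarrow> b p \<le> 0" "r \<ge> 0"
  shows "row_energy n k b r \<le> b 1 * r"
proof -
  have "row_energy n k b r = b 1 * r + (\<Sum>p\<in>{1..k} - {1}. b p * r ^ p / real n ^ (p - 1))"
    unfolding row_energy_def using assms by (subst sum.remove[of _ 1]) auto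
  also have "(\<Sum>p\<in>{1..k} - {1}. b p * r ^ p / real n ^ (p - 1)) \<le> 0"
    using assms by (intro sum_nonpos divide_nonpos_nonneg mult_nonpos_nonneg) auto
  finally show ?thesis by simp
qed

lemma row_partition_le:
  assumes "k \<ge> 1" "\<And>p. p \<in> {1..k} \<Longrightarrow> b p \<le> 0" "J \<subseteq> {1..n}"
  shows "row_partition n k b J \<le> exp (b 1) ^ card J * exp (real n * exp (b 1))"
proof -
  define q where "q = exp (b 1)"
  have q: "q > 0" by (simp add: q_def)
  have "row_partition n k b J \<le> (\<Sum>x\<in>rows_with n J. \<Prod>m=1..n. exp (b 1 * x m))"
    unfolding row_partition_def
  proof (rule sum_mono)
    fix x assume "x \<in> rows_with n J"
    then have "x m \<ge> 0" if "m \<in> {1..n}" for m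
      using that by (force simp: rows_with_def PiE_iff split: if_splits)
    then have "row_energy n k b (\<Sum>m=1..n. x m) \<le> b 1 * (\<Sum>m=1..n. x m)"
      using assms by (intro row_energy_le_linear sum_nonneg) auto
    then show "exp (row_energy n k b (\<Sum>m=1..n. x m)) \<le> (\<Prod>m=1..n. exp (b 1 * x m))"
      by (simp add: sum_distrib_left flip: exp_sum)
  qed
  \<comment> \<open>With a linear energy the entries of a row decouple as well, so the sum over rows
    factors into sums over single entries.\<close>
  also have "\<dots> = (\<Prod>m=1..n. \<Sum>y\<in>(if m \<in> J then {1} else {0, 1}). exp (b 1 * y))"
    unfolding rows_with_def by (subst prod_sum_PiE) auto
  also have "\<dots> = (\<Prod>m=1..n. if m \<in> J then q else 1 + q)"
    by (intro prod.cong) (auto simp: q_def)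
  \<comment> \<open>Free entries use \<open>1 + q \<le> exp q\<close>; forced entries are given the
    factor \<open>exp q \<ge> 1\<close> too, which makes the bound uniform in
    \<open>m\<close>.\<close>
  also have "\<dots> \<le> (\<Prod>m=1..n. (if m \<in> J then q else 1) * exp q)"
    using q by (intro prod_mono) auto
  also have "\<dots> = q ^ card J * exp q ^ n"
    using assms(3) by (simp add: prod.distrib prod.If_cases Int_absorb1)
  finally show ?thesis
    by (simp add: q_def exp_of_nat_mult)
qed

lemma row_energy_tendsto_linear:
  fixes \<alpha> \<beta> :: "nat \<Rightarrow> real"
  assumes "k \<ge> 1" "(\<lambda>n. \<alpha> n / real n) \<longlonglongrightarrow> 0"
  shows "(\<lambda>n. row_energy n k (\<lambda>p. \<beta> p * \<alpha> n) r - \<beta> 1 * \<alpha> n * r) \<longlonglongrightarrow> 0"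
proof -
  have "(\<lambda>n. \<beta> p * \<alpha> n * r ^ p / real n ^ (p - 1)) \<longlonglongrightarrow> 0" if p: "p \<ge> 2" for p
  proof -
    \<comment> \<open>Of the \<open>p - 1\<close> factors \<open>1 / n\<close>, one is paired with
      \<alpha> to give a null sequence; the remaining \<open>s = p - 2\<close> have a finite limit,
      which is 1 if \<open>s = 0\<close>.\<close>
    obtain s where s: "p = Suc (Suc s)"
      using le_Suc_ex[OF p] by auto
    have "(\<lambda>n. \<beta> p * r ^ p * (\<alpha> n / real n) * inverse (real n) ^ s)
        \<longlonglongrightarrow> \<beta> p * r ^ p * 0 * 0 ^ s"
      by (intro tendsto_mult tendsto_power tendsto_const assms(2) lim_inverse_n)
    then show ?thesis
      by (simp add: s field_simps)
  qed
  then have "(\<lambda>n. \<Sum>p\<in>{1..k} - {1}. \<beta> p * \<alpha> n * r ^ p / real n ^ (p - 1)) \<longlonglongrightarrow> 0"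
    by (intro tendsto_null_sum) auto
  moreover have "row_energy n k (\<lambda>p. \<beta> p * \<alpha> n) r - \<beta> 1 * \<alpha> n * r
      = (\<Sum>p\<in>{1..k} - {1}. \<beta> p * \<alpha> n * r ^ p / real n ^ (p - 1))" for n
    unfolding row_energy_def using assms(1) by (subst sum.remove[of _ 1]) auto
  ultimately show ?thesis by simp
qed

theorem theorem3p2:
  fixes k :: nat and \<beta> :: "nat \<Rightarrow> real" and \<alpha> :: "nat \<Rightarrow> real" and i j :: nat
  assumes "k \<ge> 1"
    and "\<And>p. p \<in> {1..k} \<Longrightarrow> \<beta> p < 0"
    and "filterlim \<alpha> at_top sequentially"
    and "(\<lambda>n. real n * exp (\<alpha> n * \<beta> 1)) \<longlonglongrightarrow> 0"
    and "(\<lambda>n. \<alpha> n / real n) \<longlonglongrightarrow> 0"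
    and "i \<ge> 1" and "j \<ge> 1" and "i \<noteq> j"
  shows "(\<lambda>n. measure (ergm n k (\<lambda>p. \<beta> p * \<alpha> n))
                 {X \<in> digraphs n. X 1 i = 1 \<and> X 1 j = 1}
               / exp (2 * \<alpha> n * \<beta> 1)) \<longlonglongrightarrow> 1"
    (is "?ratio \<longlonglongrightarrow> 1")
proof -
  \<comment> \<open>\<open>u\<close> bounds the contribution of the free entries; \<open>l\<close>
    is the weight of the indicator row of \<open>{i, j}\<close> relative to
    \<open>exp (2 * \<alpha> n * \<beta> 1)\<close>.\<close>
  define u where "u = (\<lambda>n. exp (real n * exp (\<alpha> n * \<beta> 1)))"
  define l where "l = (\<lambda>n. exp (row_energy n k (\<lambda>p. \<beta> p * \<alpha> n) 2 - \<beta> 1 * \<alpha> n * 2))"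
  have u: "u \<longlonglongrightarrow> 1"
    unfolding u_def using tendsto_exp[OF assms(4)] by simp
  have l: "l \<longlonglongrightarrow> 1"
    unfolding l_def using tendsto_exp[OF row_energy_tendsto_linear[OF assms(1,5)]] by simp
  have lu: "(\<lambda>n. l n / u n) \<longlonglongrightarrow> 1"
    using tendsto_divide[OF l u] by simp
  \<comment> \<open>Eventually \<open>n\<close> is at least \<open>max i j\<close>, so both columns
    exist, and \<alpha> is positive, so the scaled parameters are nonpositive.\<close>
  have bounds: "\<forall>\<^sub>F n in sequentially. l n / u n \<le> ?ratio n \<and> ?ratio n \<le> u n"
    using eventually_ge_at_top[of "max i j"] filterlim_at_top_dense[THEN iffD1, OF assms(3), rule_format, of 0]
  proof eventually_elim
    case (elim n)
    define b where "b = (\<lambda>p. \<beta> p * \<alpha> n)"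
    define R where "R = row_partition n k b"
    define Q where "Q = exp (2 * \<alpha> n * \<beta> 1)"
    have b: "b p \<le> 0" if "p \<in> {1..k}" for p
      using assms(2)[OF that] elim by (simp add: b_def mult_nonpos_nonneg)
    have J: "{i, j} \<subseteq> {1..n}" "1 \<in> {1..n}"
      using assms(6,7) elim by auto
    have card: "card {i, j} = 2"
      using assms(8) by simp
    have Q: "exp (b 1) ^ 2 = Q" "Q > 0"
      by (simp_all add: b_def Q_def mult_ac flip: exp_of_nat_mult)
    have un: "u n = exp (real n * exp (b 1))" "u n > 0"
      by (simp_all add: u_def b_def mult_ac)
    have ln: "l n = exp (row_energy n k b 2) / Q"
      by (simp add: l_def b_def Q_def exp_diff mult_ac)
    have ratio: "?ratio n = R {i, j} / R {} / Q"
      using prob_row_eq[OF J(2,1), of k b] by (simp add: R_def b_def Q_def)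
    have R0: "1 \<le> R {}" "R {} \<le> u n"
      using row_partition_empty_ge_1[of n k b] row_partition_le[of k b "{}" n] assms(1) b
      by (auto simp: R_def un)
    have "l n * Q \<le> R {i, j}"
      using exp_row_energy_le_row_partition[OF J(1), of k b] Q(2)
      unfolding card by (simp add: R_def ln)
    moreover have "row_partition n k b {i, j} \<le> exp (b 1) ^ card {i, j} * exp (real n * exp (b 1))"
      using assms(1) b J(1) by (rule row_partition_le)
    then have "R {i, j} \<le> Q * u n"
      unfolding card Q(1) R_def un .
    ultimately have R2: "l n * Q \<le> R {i, j}" "R {i, j} \<le> Q * u n" .
    have "l n / u n = l n * Q / u n / Q"
      using Q(2) by simp
    \<comment> \<open>Smallest numerator over largest denominator, \<open>R {} \<le> u n\<close>;
      hence the lower bound is \<open>l n / u n\<close> and not \<open>l n\<close>. The upper bound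
      uses \<open>R {} \<ge> 1\<close>.\<close>
    also have "\<dots> \<le> R {i, j} / R {} / Q"
      using R0 R2(1) Q(2) row_partition_pos[OF J(1), of k b]
      by (intro divide_right_mono frac_le) (auto simp: R_def)
    finally have "l n / u n \<le> ?ratio n" unfolding ratio .
    moreover have "R {i, j} / R {} / Q \<le> Q * u n / 1 / Q"
      using R0 R2(2) Q(2) un(2) by (intro divide_right_mono frac_le) auto
    ultimately show ?case
      using Q(2) unfolding ratio by simp
  qed
  show ?thesis
    using bounds by (intro real_tendsto_sandwich[OF _ _ lu u]) (auto elim: eventually_mono)
qed

end
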